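(* For almost every $f\in\Omega$ (with respect to the probability $P$ on $\Omega$), $$\liminf_{m\to\infty}\frac{\|\widehat{\pi_m(f)}\|_\infty}{2^{m/2}\sqrt m}\ge\frac{\log 2}{2}.$$
   Context: $V_m=\mathbb{F}_2^m$, embedded in $V_{m+1}$ by $(x_1,\dots,x_m)\mapsto(x_1,\dots,x_m,0)$; $V_\infty=\bigcup_m V_m=\mathbb{F}_2^{(\mathbb{N})}$ is the space of sequences in $\mathbb{F}_2$ with finitely many nonzero terms. $\Omega=\{\pm1\}^{V_\infty}$ is the set of all functions $V_\infty\to\{\pm1\}$, $\Omega_m$ the set of functions $V_m\to\{\pm1\}$, and $\pi_m:\Omega\to\Omega_m$ is restriction to $V_m$. $\Omega$ carries the $\sigma$-algebra generated by the sets $\pi_m^{-1}(A)$, $A\subseteq\Omega_m$, $m\ge1$, and the probability $P$ determined by $P(\pi_m^{-1}(\{g\}))=2^{-2^m}$ for every $g\in\Omega_m$ (i.e. the values $f(x)$, $x\in V_\infty$, are independent and uniform on $\{\pm1\}$). For $g:V_m\to\{\pm1\}$, $\widehat g(\chi)=\sum_{x\in V_m}g(x)\chi(x)$ for each character (homomorphism) $\chi:V_m\to\{\pm1\}$, and $\|\widehat g\|_\infty=\max_\chi|\widehat g(\chi)|$. $\log$ is the natural logarithm. *)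

theory Defs
  imports "HOL-Probability.Probability" "HOL-Library.Poly_Mapping" "HOL-Library.Z2"
begin

text \<open>
  The space \<open>V\<^sub>\<infinity>\<close> is the whole type of finitely supported sequences
  over \<^typ>\<open>bit\<close>; addition is pointwise. Coordinates are numbered from 0, so
  \<open>V m\<close> consists of the sequences vanishing from index \<open>m\<close> on and the
  embeddings of \<open>V m\<close> into \<open>V (Suc m)\<close> are inclusions.
\<close>

type_synonym V_inf = "nat \<Rightarrow>\<^sub>0 bit"

definition V :: "nat \<Rightarrow> V_inf set" where
  "V m = {x. \<forall>i\<ge>m. Poly_Mapping.lookup x i = 0}"

definition Omega :: "(V_inf \<Rightarrow> real) set" where
  "Omega = UNIV \<rightarrow>\<^sub>E {-1, 1}"

definition Omega_fin :: "nat \<Rightarrow> (V_inf \<Rightarrow> real) set" where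
  "Omega_fin m = V m \<rightarrow>\<^sub>E {-1, 1}"

definition proj :: "nat \<Rightarrow> (V_inf \<Rightarrow> real) \<Rightarrow> V_inf \<Rightarrow> real" where
  "proj m f = restrict f (V m)"

text \<open>
  The product of uniform measures; \<open>sets_P\<close>, \<open>emeasure_P_cylinder\<close> and
  \<open>P_unique\<close> below show that this is the probability determined by the
  cylinder sets.
\<close>

definition P_Omega :: "(V_inf \<Rightarrow> real) measure" where
  "P_Omega = (\<Pi>\<^sub>M x\<in>UNIV. uniform_count_measure {-1, 1})"

definition characters :: "nat \<Rightarrow> (V_inf \<Rightarrow> real) set" where
  "characters m = {\<psi> \<in> V m \<rightarrow>\<^sub>E {-1, 1}. \<forall>x\<in>V m. \<forall>y\<in>V m. \<psi> (x + y) = \<psi> x * \<psi> y}"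

definition fourier :: "nat \<Rightarrow> (V_inf \<Rightarrow> real) \<Rightarrow> (V_inf \<Rightarrow> real) \<Rightarrow> real" where
  "fourier m g \<psi> = (\<Sum>x\<in>V m. g x * \<psi> x)"

definition fourier_sup_norm :: "nat \<Rightarrow> (V_inf \<Rightarrow> real) \<Rightarrow> real" where
  "fourier_sup_norm m g = Max ((\<lambda>\<psi>. \<bar>fourier m g \<psi>\<bar>) ` characters m)"


lemma V_mono: "m \<le> n \<Longrightarrow> V m \<subseteq> V n"
  by (auto simp: V_def)

lemma V_add: "x \<in> V m \<Longrightarrow> y \<in> V m \<Longrightarrow> x + y \<in> V m"
  by (simp add: V_def Poly_Mapping.lookup_add)

lemma UN_V: "(\<Union>m. V m) = UNIV"
proof -
  have "\<exists>m. x \<in> V m" for x :: V_inf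
  proof -
    have "finite (Poly_Mapping.keys x)" by simp
    then obtain m where "\<forall>i\<in>Poly_Mapping.keys x. i < m"
      using finite_nat_set_iff_bounded by blast
    then have "Poly_Mapping.lookup x i = 0" if "i \<ge> m" for i
      using that Poly_Mapping.in_keys_iff[of i x] by (meson leD)
    then have "x \<in> V m"
      by (simp add: V_def)
    then show ?thesis ..
  qed
  then show ?thesis by auto
qed

lemma bij_betw_V_Pow: "bij_betw Poly_Mapping.keys (V m) (Pow {..<m})"
proof (rule bij_betwI')
  fix x y :: V_inf
  assume "x \<in> V m" "y \<in> V m"
  have "x = y" if "Poly_Mapping.keys x = Poly_Mapping.keys y"
  proof (rule poly_mapping_eqI)
    fix i
    have "Poly_Mapping.lookup x i = 0 \<longleftrightarrow> Poly_Mapping.lookup y i = 0"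
      using that by (metis Poly_Mapping.in_keys_iff)
    then show "Poly_Mapping.lookup x i = Poly_Mapping.lookup y i"
      by (metis bit_not_zero_iff)
  qed
  then show "(Poly_Mapping.keys x = Poly_Mapping.keys y) = (x = y)" by auto
next
  fix x assume "x \<in> V m"
  then show "Poly_Mapping.keys x \<in> Pow {..<m}"
    by (auto simp: V_def Poly_Mapping.in_keys_iff not_le[symmetric])
next
  fix A assume A: "A \<in> Pow {..<m}"
  define f :: "nat \<Rightarrow> bit" where "f i = (if i \<in> A then 1 else 0)" for i
  have fin: "finite {i. f i \<noteq> 0}"
    using A by (auto simp: f_def intro: finite_subset)
  then have l: "Poly_Mapping.lookup (Abs_poly_mapping f) = f" by simp
  have "Poly_Mapping.keys (Abs_poly_mapping f) = A"
    by (auto simp: Poly_Mapping.in_keys_iff l f_def split: if_splits)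
  moreover have "Abs_poly_mapping f \<in> V m"
    using A by (auto simp: V_def l f_def)
  ultimately show "\<exists>x\<in>V m. A = Poly_Mapping.keys x" by auto
qed

lemma finite_V: "finite (V m)"
  using bij_betw_finite[OF bij_betw_V_Pow[of m]] by simp

lemma card_V: "card (V m) = 2 ^ m"
  using bij_betw_same_card[OF bij_betw_V_Pow[of m]] by (simp add: card_Pow)

lemma finite_characters: "finite (characters m)"
  by (rule finite_subset[of _ "V m \<rightarrow>\<^sub>E {-1, 1}"])
    (auto simp: characters_def intro!: finite_PiE finite_V)

lemma characters_nonempty: "characters m \<noteq> {}"
proof -
  have "restrict (\<lambda>_. 1) (V m) \<in> characters m"
    by (auto simp: characters_def V_add)
  then show ?thesis by auto
qed

lemma finite_Omega_fin: "finite (Omega_fin m)"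
  by (auto simp: Omega_fin_def intro!: finite_PiE finite_V)

lemma product_prob_space_signs:
  "product_prob_space (\<lambda>_::V_inf. uniform_count_measure {-1, 1::real})"
  by (intro product_prob_spaceI prob_space_uniform_count_measure) auto

lemma prob_space_P: "prob_space P_Omega"
  unfolding P_Omega_def
  by (intro prob_space_PiM prob_space_uniform_count_measure) auto

lemma space_P: "space P_Omega = Omega"
  by (simp add: P_Omega_def Omega_def space_PiM space_uniform_count_measure)

lemma cylinder_eq_emb:
  assumes "g \<in> Omega_fin m"
  shows "proj m -` {g} \<inter> Omega =
    prod_emb UNIV (\<lambda>_. uniform_count_measure {-1, 1}) (V m) (\<Pi>\<^sub>E x\<in>V m. {g x})"
proof -
  have g: "(\<Pi>\<^sub>E x\<in>V m. {g x}) = {g}"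
    using assms by (intro PiE_singleton) (auto simp: Omega_fin_def PiE_iff)
  show ?thesis
    unfolding g prod_emb_def Omega_def proj_def by (simp add: space_uniform_count_measure)
qed

lemma emeasure_P_cylinder:
  assumes "g \<in> Omega_fin m"
  shows "emeasure P_Omega (proj m -` {g} \<inter> Omega) = ennreal (1 / 2 ^ (2 ^ m))"
proof -
  interpret product_prob_space "\<lambda>_::V_inf. uniform_count_measure {-1, 1::real}" UNIV
    by (rule product_prob_space_signs)
  have g: "g x \<in> {-1, 1}" if "x \<in> V m" for x
    using assms that by (auto simp: Omega_fin_def)
  have "emeasure P_Omega (proj m -` {g} \<inter> Omega) =
      (\<Prod>x\<in>V m. emeasure (uniform_count_measure {-1, 1::real}) {g x})"
    unfolding P_Omega_def cylinder_eq_emb[OF assms] using g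
    by (intro emeasure_PiM_emb finite_V) (auto simp: sets_uniform_count_measure)
  also have "\<dots> = (\<Prod>x\<in>V m. ennreal (1 / 2))"
    using g by (intro prod.cong refl, subst emeasure_uniform_count_measure) auto
  also have "\<dots> = ennreal (1 / 2 ^ (2 ^ m))"
    by (simp only: prod_constant card_V) (subst ennreal_power, simp_all add: power_one_over)
  finally show ?thesis .
qed

definition cylinders :: "(V_inf \<Rightarrow> real) set set" where
  "cylinders = {proj m -` A \<inter> Omega | m A. 1 \<le> m \<and> A \<subseteq> Omega_fin m}"

lemma cylinder_in_sets:
  assumes "A \<subseteq> Omega_fin m"
  shows "proj m -` A \<inter> Omega \<in> sets P_Omega"
proof -
  have "proj m -` {g} \<inter> Omega \<in> sets P_Omega" if "g \<in> A" for g
  proof -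
    have g: "g \<in> Omega_fin m" using assms that by auto
    show ?thesis
      unfolding P_Omega_def cylinder_eq_emb[OF g] using g
      by (intro sets_PiM_I finite_V) (auto simp: Omega_fin_def sets_uniform_count_measure)
  qed
  then have "(\<Union>g\<in>A. proj m -` {g} \<inter> Omega) \<in> sets P_Omega"
    by (intro sets.finite_UN finite_subset[OF assms finite_Omega_fin])
  also have "(\<Union>g\<in>A. proj m -` {g} \<inter> Omega) = proj m -` A \<inter> Omega" by auto
  finally show ?thesis .
qed

lemma sets_P: "sets P_Omega = sigma_sets Omega cylinders"
proof
  show "sigma_sets Omega cylinders \<subseteq> sets P_Omega"
    unfolding space_P[symmetric]
    by (intro sets.sigma_sets_subset) (auto simp: cylinders_def cylinder_in_sets)
next
  show "sets P_Omega \<subseteq> sigma_sets Omega cylinders"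
  proof -
    let ?G = "{{f \<in> UNIV \<rightarrow>\<^sub>E {-1, 1}. f i \<in> A} |i A. A \<in> sets (uniform_count_measure {-1, 1::real})}
      :: (V_inf \<Rightarrow> real) set set"
    have "?G \<subseteq> sigma_sets Omega cylinders"
    proof
      fix B
      assume "B \<in> ?G"
      then obtain i A where B: "B = {f \<in> Omega. f i \<in> A}" unfolding Omega_def by auto
      obtain m where m: "i \<in> V m" using UN_V by blast
      then have i: "i \<in> V (Suc m)" using V_mono[of m "Suc m"] by auto
      have "B = proj (Suc m) -` {g \<in> Omega_fin (Suc m). g i \<in> A} \<inter> Omega"
        using i by (auto simp: B proj_def Omega_def Omega_fin_def)
      moreover have "proj (Suc m) -` {g \<in> Omega_fin (Suc m). g i \<in> A} \<inter> Omega \<in> cylinders"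
        unfolding cylinders_def
        by (intro CollectI exI[of _ "Suc m"] exI[of _ "{g \<in> Omega_fin (Suc m). g i \<in> A}"]) auto
      ultimately show "B \<in> sigma_sets Omega cylinders" by auto
    qed
    then have "sigma_sets Omega ?G \<subseteq> sigma_sets Omega cylinders"
      by (rule sigma_sets_mono)
    then show ?thesis
      unfolding P_Omega_def sets_PiM_single space_uniform_count_measure Omega_def by simp
  qed
qed

lemma Int_stable_cylinders: "Int_stable cylinders"
proof (rule Int_stableI)
  fix B C assume "B \<in> cylinders" "C \<in> cylinders"
  then obtain m A n A' where *: "B = proj m -` A \<inter> Omega" "C = proj n -` A' \<inter> Omega"
    "1 \<le> m" "1 \<le> n" by (auto simp: cylinders_def)
  define k where "k = max m n"
  have p: "proj m (proj k f) = proj m f" "proj n (proj k f) = proj n f" for f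
    using V_mono[of m k] V_mono[of n k]
    by (auto simp: proj_def k_def restrict_restrict Int_absorb1)
  have o: "proj k f \<in> Omega_fin k" if "f \<in> Omega" for f
    using that by (auto simp: proj_def Omega_def Omega_fin_def)
  have "B \<inter> C = proj k -` {g \<in> Omega_fin k. proj m g \<in> A \<and> proj n g \<in> A'} \<inter> Omega"
    by (auto simp: * p o)
  moreover have "1 \<le> k" using * by (simp add: k_def)
  ultimately show "B \<inter> C \<in> cylinders"
    unfolding cylinders_def by blast
qed

lemma P_unique:
  assumes sets: "sets M = sigma_sets Omega cylinders"
    and cyl: "\<And>m g. 1 \<le> m \<Longrightarrow> g \<in> Omega_fin m \<Longrightarrow>
      emeasure M (proj m -` {g} \<inter> Omega) = ennreal (1 / 2 ^ (2 ^ m))"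
  shows "M = P_Omega"
proof (rule measure_eqI_generator_eq[where E = cylinders and \<Omega> = Omega and A = "\<lambda>_. Omega"])
  show "cylinders \<subseteq> Pow Omega" by (auto simp: cylinders_def)
  have o: "proj 1 f \<in> Omega_fin 1" if "f \<in> Omega" for f
    using that by (auto simp: proj_def Omega_def Omega_fin_def)
  have "Omega = proj 1 -` Omega_fin 1 \<inter> Omega" using o by auto
  then have O: "Omega \<in> cylinders" unfolding cylinders_def by blast
  then show "range (\<lambda>_::nat. Omega) \<subseteq> cylinders" by auto
  fix B assume "B \<in> cylinders"
  then obtain m A where B: "B = proj m -` A \<inter> Omega" "1 \<le> m" "A \<subseteq> Omega_fin m"
    by (auto simp: cylinders_def)
  have fin: "finite A" using B(3) finite_Omega_fin finite_subset by blast
  have eq: "emeasure N B = (\<Sum>g\<in>A. emeasure N (proj m -` {g} \<inter> Omega))"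
    if "sets N = sigma_sets Omega cylinders" for N
  proof -
    have "proj m -` {g} \<inter> Omega \<in> cylinders" if "g \<in> A" for g
      using B that unfolding cylinders_def by blast
    then have "(\<lambda>g. proj m -` {g} \<inter> Omega) ` A \<subseteq> sets N"
      using that by auto
    then have "(\<Sum>g\<in>A. emeasure N (proj m -` {g} \<inter> Omega)) =
        emeasure N (\<Union>g\<in>A. proj m -` {g} \<inter> Omega)"
      by (intro sum_emeasure fin) (auto simp: disjoint_family_on_def)
    also have "(\<Union>g\<in>A. proj m -` {g} \<inter> Omega) = B" using B by auto
    finally show ?thesis by simp
  qed
  show 1: "emeasure M B = emeasure P_Omega B"
    unfolding eq[OF sets] eq[OF sets_P] using B
    by (intro sum.cong refl) (auto simp: cyl emeasure_P_cylinder)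
next
  fix i :: nat
  have o: "proj 1 f \<in> Omega_fin 1" if "f \<in> Omega" for f
    using that by (auto simp: proj_def Omega_def Omega_fin_def)
  have O: "Omega = (\<Union>g\<in>Omega_fin 1. proj 1 -` {g} \<inter> Omega)" using o by auto
  have "emeasure M Omega \<le> (\<Sum>g\<in>Omega_fin 1. emeasure M (proj 1 -` {g} \<inter> Omega))"
    by (subst O, intro emeasure_subadditive_finite finite_Omega_fin)
      (auto simp: sets cylinders_def)
  also have "\<dots> < \<infinity>"
    by (simp add: cyl ennreal_mult_less_top of_nat_less_top)
  finally show "emeasure M Omega \<noteq> \<infinity>" by auto
qed (auto simp: sets sets_P Int_stable_cylinders)

end

(* Write S(psi) for the Fourier coefficient of f at psi on V_m, n = 2^m, and
   W = sum over psi of exp(l * S(psi)) with l = ln 2 * sqrt m / 2^(m/2). Each summand has mean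
   cosh(l)^n. Two of them have E exp(l * (S(psi) + S(phi))) <= cosh(l)^(2n) * exp(l^2 <psi, phi>),
   so by orthogonality distinct ones are nonpositively correlated and only the diagonal contributes
   to the variance. By Chebyshev, W exceeds half its mean outside an event of probability at most
   4 exp(l^2 n) / 2^m = 4 exp(((ln 2)^2 - ln 2) m), which is summable, so Borel-Cantelli applies.
   When W exceeds half its mean, the largest |S(psi)| is at least (n ln cosh l - ln 2) / l, which
   is asymptotic to n l / 2. *)

theory Submission
  imports Defs "HOL-Real_Asymp.Real_Asymp"
begin

section \<open>Hyperbolic estimates and exponential moments of independent signs\<close>

lemma one_plus_half_square_le_cosh: "1 + l\<^sup>2 / 2 \<le> cosh (l::real)"
proof -
  \<comment> \<open>By the half-angle formula below, the claim reduces to |x| <= |sinh x| at x = l /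
    2.\<close>
  have "\<bar>l / 2\<bar> \<le> \<bar>sinh (l / 2)\<bar>"
    using real_le_abs_sinh[of "l / 2"] by (simp add: sinh_field_def exp_minus)
  then have "(l / 2)\<^sup>2 \<le> (sinh (l / 2))\<^sup>2"
    by (simp only: abs_le_square_iff)
  moreover have "cosh l = 1 + 2 * (sinh (l / 2))\<^sup>2"
    using cosh_double[of "l / 2"] by (simp add: cosh_square_eq)
  ultimately show ?thesis
    by (simp add: power_divide)
qed

lemma tanh_square_le: "(tanh l)\<^sup>2 \<le> (l::real)\<^sup>2"
proof -
  have *: "tanh x \<le> x" if "0 \<le> x" for x :: real
  proof -
    \<comment> \<open>The derivative of x - tanh x is tanh^2 x.\<close>
    have "0 - tanh 0 \<le> x - tanh x"
      by (rule DERIV_nonneg_imp_nondecreasing[OF that])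
        (auto intro!: exI derivative_eq_intros)
    then show ?thesis by simp
  qed
  have "\<bar>tanh l\<bar> \<le> \<bar>l\<bar>"
    using *[of "\<bar>l\<bar>"] by simp
  then show ?thesis
    by (simp add: abs_le_square_iff)
qed

text \<open>The two values of \<open>a * b\<close> give cosh^2 + sinh^2 = cosh (2 l) and cosh^2 -
  sinh^2 = 1; then 1 + t <= exp t. The exponential form turns a product over points into the inner
  product of two characters.\<close>

lemma cosh_sum_of_signs_le:
  assumes "a \<in> {-1, 1}" "b \<in> {-1, 1::real}"
  shows "cosh (l * (a + b)) \<le> (cosh l)\<^sup>2 * exp ((tanh l)\<^sup>2 * (a * b))"
proof -
  have "cosh (l * (a + b)) = (cosh l)\<^sup>2 + a * b * (sinh l)\<^sup>2"
    using assms cosh_double[of l] cosh_minus[of "2 * l"]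
    by (auto simp: cosh_square_eq algebra_simps)
  also have "\<dots> = (cosh l)\<^sup>2 * (1 + (tanh l)\<^sup>2 * (a * b))"
    by (simp add: tanh_def power_divide field_simps)
  also have "\<dots> \<le> (cosh l)\<^sup>2 * exp ((tanh l)\<^sup>2 * (a * b))"
    by (intro mult_left_mono exp_ge_add_one_self) simp
  finally show ?thesis .
qed

text \<open>The unnormalised moment generating function of independent signs: the exponential
  factorises over the coordinates.\<close>

lemma sum_exp_over_signs:
  fixes c :: "'a \<Rightarrow> real"
  assumes "finite A"
  shows "(\<Sum>g\<in>A \<rightarrow>\<^sub>E {-1, 1}. exp (\<Sum>x\<in>A. c x * g x)) = 2 ^ card A * (\<Prod>x\<in>A. cosh (c x))"
proof -
  have "(\<Sum>g\<in>A \<rightarrow>\<^sub>E {-1, 1}. exp (\<Sum>x\<in>A. c x * g x)) =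
      (\<Prod>x\<in>A. \<Sum>y\<in>{-1, 1}. exp (c x * y))"
    using assms by (simp only: exp_sum) (rule prod_sum_PiE[symmetric], auto)
  also have "\<dots> = (\<Prod>x\<in>A. 2 * cosh (c x))"
    by (intro prod.cong refl) (simp add: cosh_field_def)
  finally show ?thesis
    by (simp add: prod.distrib)
qed

subsection \<open>Characters\<close>

lemma bit_add_self: "b + b = (0 :: bit)"
  by (cases b) auto

lemma V_inf_add_self: "x + x = (0 :: V_inf)"
  by (rule poly_mapping_eqI)
    (simp only: Poly_Mapping.lookup_add bit_add_self Poly_Mapping.lookup_zero)

lemma characters_sign: "\<psi> \<in> characters m \<Longrightarrow> x \<in> V m \<Longrightarrow> \<psi> x \<in> {-1, 1}"
  by (auto simp: characters_def)

text \<open>Translation by a point \<open>y\<close> where the characters differ permutes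
  \<open>V m\<close> and multiplies the sum by -1, so the sum vanishes.\<close>

lemma sum_mult_characters:
  assumes "\<psi> \<in> characters m" "\<phi> \<in> characters m"
  shows "(\<Sum>x\<in>V m. \<psi> x * \<phi> x) = (if \<psi> = \<phi> then 2 ^ m else 0)"
proof (cases "\<psi> = \<phi>")
  case True
  have "(\<Sum>x\<in>V m. \<psi> x * \<phi> x) = (\<Sum>x\<in>V m. 1)"
    using True characters_sign[OF assms(1)] by (intro sum.cong refl) fastforce
  then show ?thesis
    using True by (simp add: card_V)
next
  case False
  then obtain y where y: "y \<in> V m" "\<psi> y \<noteq> \<phi> y"
    using assms PiE_ext[of \<psi> "V m" "\<lambda>_. {-1, 1}" \<phi>] by (auto simp: characters_def)
  have sgn: "\<psi> y * \<phi> y = -1"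
    using y characters_sign[OF assms(1)] characters_sign[OF assms(2)] by fastforce
  have invol: "x + y + y = x" for x
    by (simp add: add.assoc V_inf_add_self)
  have "(\<Sum>x\<in>V m. \<psi> x * \<phi> x) = (\<Sum>x\<in>V m. \<psi> (x + y) * \<phi> (x + y))"
    by (rule sum.reindex_bij_witness[of _ "\<lambda>x. x + y" "\<lambda>x. x + y"])
      (simp_all add: invol V_add y)
  also have "\<dots> = (\<Sum>x\<in>V m. (\<psi> y * \<phi> y) * (\<psi> x * \<phi> x))"
    using assms y by (intro sum.cong refl) (simp add: characters_def)
  also have "\<dots> = - (\<Sum>x\<in>V m. \<psi> x * \<phi> x)"
    unfolding sgn by (simp add: sum_negf)
  finally show ?thesis
    using False by simp
qed

text \<open>The Walsh functions \<open>X A\<close>, one for each set of coordinates below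
  \<open>m\<close>, are distinct characters.\<close>

lemma card_characters_ge: "2 ^ m \<le> card (characters m)"
proof -
  define s :: "bit \<Rightarrow> real" where "s b = (if b = 0 then 1 else -1)" for b
  define X where "X A = restrict (\<lambda>x. \<Prod>i\<in>A. s (Poly_Mapping.lookup x i)) (V m)" for A
  have s_add: "s (a + b) = s a * s b" for a b
    by (cases a; cases b) (auto simp: s_def)
  have s_prod: "(\<Prod>i\<in>A. s (h i)) \<in> {-1, 1}" for A and h :: "nat \<Rightarrow> bit"
    by (induction A rule: infinite_finite_induct) (auto simp: s_def)
  have "X A \<in> characters m" for A
    unfolding characters_def
  proof (intro CollectI conjI ballI)
    show "X A \<in> V m \<rightarrow>\<^sub>E {-1, 1}"
      using s_prod unfolding X_def by simp
    show "X A (x + y) = X A x * X A y" if "x \<in> V m" "y \<in> V m" for x y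
      using that by (simp only: X_def restrict_apply V_add Poly_Mapping.lookup_add s_add
          prod.distrib if_True)
  qed
  moreover have "inj_on X (Pow {..<m})"
  proof (rule inj_onI)
    fix A B assume A: "A \<in> Pow {..<m}" and B: "B \<in> Pow {..<m}" and eq: "X A = X B"
    \<comment> \<open>Evaluation at the unit vectors recovers \<open>A\<close> from
      \<open>X A\<close>.\<close>
    have X_single: "X C (Poly_Mapping.single i 1) = (if i \<in> C then -1 else 1)"
      if "i < m" "C \<in> Pow {..<m}" for i C
    proof -
      have "finite C" using that finite_subset by auto
      have "X C (Poly_Mapping.single i 1) = (\<Prod>j\<in>C. if j = i then -1 else 1)"
        using that by (auto simp: X_def V_def s_def Poly_Mapping.lookup_single when_def
            intro!: prod.cong)
      then show ?thesis
        using \<open>finite C\<close> by (simp add: prod.delta)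
    qed
    have "i \<in> A \<longleftrightarrow> i \<in> B" if "i < m" for i
      using X_single[OF that A] X_single[OF that B] eq by (auto split: if_splits)
    then show "A = B"
      using A B by blast
  qed
  ultimately have "card (Pow {..<m}) \<le> card (characters m)"
    by (intro card_inj_on_le finite_characters) auto
  then show ?thesis
    by (simp add: card_Pow)
qed

subsection \<open>Exponential sums over the characters\<close>

lemma card_Omega_fin: "card (Omega_fin m) = 2 ^ 2 ^ m"
  by (simp add: Omega_fin_def card_PiE finite_V card_V numeral_2_eq_2)

lemma sum_exp_fourier:
  assumes "\<psi> \<in> characters m"
  shows "(\<Sum>g\<in>Omega_fin m. exp (l * fourier m g \<psi>)) = 2 ^ 2 ^ m * cosh l ^ 2 ^ m"
proof -
  have "(\<Sum>g\<in>Omega_fin m. exp (l * fourier m g \<psi>)) =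
      (\<Sum>g\<in>Omega_fin m. exp (\<Sum>x\<in>V m. (l * \<psi> x) * g x))"
    by (simp add: fourier_def sum_distrib_left mult_ac)
  also have "\<dots> = 2 ^ 2 ^ m * (\<Prod>x\<in>V m. cosh (l * \<psi> x))"
    unfolding Omega_fin_def by (subst sum_exp_over_signs) (simp_all add: finite_V card_V)
  also have "(\<Prod>x\<in>V m. cosh (l * \<psi> x)) = (\<Prod>x\<in>V m. cosh l)"
    using characters_sign[OF assms] by (intro prod.cong refl) fastforce
  finally show ?thesis
    by (simp add: card_V)
qed

text \<open>The pointwise bound multiplies up to exp (tanh^2 l * <\<psi>, \<phi>>), which
  orthogonality evaluates. For \<psi> \<noteq> \<phi> the resulting bound is the product of the two
  means, hence nonpositive covariance.\<close>

lemma sum_exp_fourier_pair_le: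
  assumes "\<psi> \<in> characters m" "\<phi> \<in> characters m"
  shows "(\<Sum>g\<in>Omega_fin m. exp (l * fourier m g \<psi>) * exp (l * fourier m g \<phi>))
    \<le> 2 ^ 2 ^ m * (cosh l ^ 2 ^ m)\<^sup>2 * (if \<psi> = \<phi> then exp (l\<^sup>2 * 2 ^ m) else 1)"
proof -
  have "(\<Sum>g\<in>Omega_fin m. exp (l * fourier m g \<psi>) * exp (l * fourier m g \<phi>)) =
      (\<Sum>g\<in>Omega_fin m. exp (\<Sum>x\<in>V m. (l * (\<psi> x + \<phi> x)) * g x))"
    by (simp add: fourier_def sum_distrib_left algebra_simps sum.distrib flip: exp_add)
  also have "\<dots> = 2 ^ 2 ^ m * (\<Prod>x\<in>V m. cosh (l * (\<psi> x + \<phi> x)))"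
    unfolding Omega_fin_def by (subst sum_exp_over_signs) (simp_all add: finite_V card_V)
  also have "(\<Prod>x\<in>V m. cosh (l * (\<psi> x + \<phi> x))) \<le>
      (\<Prod>x\<in>V m. (cosh l)\<^sup>2 * exp ((tanh l)\<^sup>2 * (\<psi> x * \<phi> x)))"
    using assms by (intro prod_mono conjI cosh_sum_of_signs_le characters_sign) auto
  also have "\<dots> = (cosh l ^ 2 ^ m)\<^sup>2 * exp ((tanh l)\<^sup>2 * (\<Sum>x\<in>V m. \<psi> x * \<phi> x))"
    by (simp add: prod.distrib card_V finite_V exp_sum sum_distrib_left mult.commute
        flip: power_mult)
  also have "\<dots> \<le> (cosh l ^ 2 ^ m)\<^sup>2 * (if \<psi> = \<phi> then exp (l\<^sup>2 * 2 ^ m) else 1)"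
    by (intro mult_left_mono) (simp_all add: sum_mult_characters[OF assms] tanh_square_le)
  finally show ?thesis
    by (simp add: mult.assoc)
qed

section \<open>Second moment of the exponential sum and Chebyshev's inequality\<close>

definition char_exp_sum :: "nat \<Rightarrow> real \<Rightarrow> (V_inf \<Rightarrow> real) \<Rightarrow> real" where
  "char_exp_sum m l g = (\<Sum>\<psi>\<in>characters m. exp (l * fourier m g \<psi>))"

definition char_exp_mean :: "nat \<Rightarrow> real \<Rightarrow> real" where
  "char_exp_mean m l = card (characters m) * cosh l ^ 2 ^ m"

definition atypical :: "nat \<Rightarrow> real \<Rightarrow> (V_inf \<Rightarrow> real) set" where
  "atypical m l = {g \<in> Omega_fin m. char_exp_sum m l g \<le> char_exp_mean m l / 2}"

lemma sum_char_exp_sum: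
  "(\<Sum>g\<in>Omega_fin m. char_exp_sum m l g) = 2 ^ 2 ^ m * char_exp_mean m l"
  unfolding char_exp_sum_def char_exp_mean_def
  by (subst sum.swap) (simp add: sum_exp_fourier)

lemma sum_char_exp_sum_square_le:
  "(\<Sum>g\<in>Omega_fin m. (char_exp_sum m l g)\<^sup>2) \<le>
    2 ^ 2 ^ m * (cosh l ^ 2 ^ m)\<^sup>2 * card (characters m) * (card (characters m) + exp (l\<^sup>2 * 2 ^ m))"
proof -
  let ?E = "\<lambda>g \<psi>. exp (l * fourier m g \<psi>)" and ?X = "characters m"
  let ?e = "exp (l\<^sup>2 * 2 ^ m)" and ?c = "2 ^ 2 ^ m * (cosh l ^ 2 ^ m)\<^sup>2"
  have "(\<Sum>g\<in>Omega_fin m. (char_exp_sum m l g)\<^sup>2) =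
      (\<Sum>g\<in>Omega_fin m. \<Sum>\<psi>\<in>?X. \<Sum>\<phi>\<in>?X. ?E g \<psi> * ?E g \<phi>)"
    by (simp add: char_exp_sum_def power2_eq_square sum_product)
  also have "\<dots> = (\<Sum>\<psi>\<in>?X. \<Sum>g\<in>Omega_fin m. \<Sum>\<phi>\<in>?X. ?E g \<psi> * ?E g \<phi>)"
    by (rule sum.swap)
  also have "\<dots> = (\<Sum>\<psi>\<in>?X. \<Sum>\<phi>\<in>?X. \<Sum>g\<in>Omega_fin m. ?E g \<psi> * ?E g \<phi>)"
    by (intro sum.cong refl sum.swap)
  also have "\<dots> \<le> (\<Sum>\<psi>\<in>?X. \<Sum>\<phi>\<in>?X. ?c * (if \<psi> = \<phi> then ?e else 1))"
    by (intro sum_mono sum_exp_fourier_pair_le)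
  \<comment> \<open>With 1 added on the diagonal too, the constant terms sum to exactly the squared
    mean, which cancels in the variance.\<close>
  also have "\<dots> \<le> (\<Sum>\<psi>\<in>?X. \<Sum>\<phi>\<in>?X. ?c * (1 + (if \<psi> = \<phi> then ?e else 0)))"
    by (intro sum_mono mult_left_mono) auto
  also have "\<dots> = (\<Sum>\<psi>\<in>?X. ?c * (card ?X + ?e))"
    by (intro sum.cong refl) (simp add: sum.distrib finite_characters flip: sum_distrib_left)
  finally show ?thesis
    by (simp add: mult_ac)
qed

text \<open>Chebyshev by counting: the total squared deviation is at most
  \<open>n * C\<^sup>2 * K * e\<close>, while each atypical function contributes at least
  \<open>(K * C / 2)\<^sup>2\<close>.\<close>

lemma card_atypical_le:
  "real (card (atypical m l)) / 2 ^ 2 ^ m \<le> 4 * (exp (l\<^sup>2 * 2 ^ m) / 2 ^ m)"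
proof -
  define K where "K = real (card (characters m))"
  define C where "C = cosh l ^ 2 ^ m"
  define e where "e = exp (l\<^sup>2 * 2 ^ m)"
  define n where "n = (2::real) ^ 2 ^ m"
  define W where "W = char_exp_sum m l"
  have K: "2 ^ m \<le> K"
    using card_characters_ge[of m] unfolding K_def by (metis of_nat_le_iff of_nat_numeral of_nat_power)
  have pos: "0 < K" "0 < C" "0 < n" "0 < e"
    using K by (auto simp: C_def n_def e_def intro: less_le_trans[of _ "2 ^ m"])
  have mean: "char_exp_mean m l = K * C"
    by (simp add: char_exp_mean_def K_def C_def)
  have "card (atypical m l) * (K * C / 2)\<^sup>2 = (\<Sum>g\<in>atypical m l. (K * C / 2)\<^sup>2)"
    by simp
  also have "\<dots> \<le> (\<Sum>g\<in>atypical m l. (W g - K * C)\<^sup>2)"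
  proof (rule sum_mono)
    fix g assume "g \<in> atypical m l"
    then have "K * C / 2 \<le> K * C - W g"
      by (simp add: atypical_def mean W_def mult.commute)
    then have "(K * C / 2)\<^sup>2 \<le> (K * C - W g)\<^sup>2"
      using pos by (intro power_mono) auto
    then show "(K * C / 2)\<^sup>2 \<le> (W g - K * C)\<^sup>2"
      by (simp add: power2_commute)
  qed
  also have "\<dots> \<le> (\<Sum>g\<in>Omega_fin m. (W g - K * C)\<^sup>2)"
    by (intro sum_mono2 finite_Omega_fin) (auto simp: atypical_def)
  also have "\<dots> = (\<Sum>g\<in>Omega_fin m. (W g)\<^sup>2) - 2 * (K * C) * (\<Sum>g\<in>Omega_fin m. W g) + n * (K * C)\<^sup>2"
    by (simp add: power2_diff sum.distrib sum_subtractf card_Omega_fin n_def sum_distrib_left mult_ac)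
  also have "\<dots> = (\<Sum>g\<in>Omega_fin m. (W g)\<^sup>2) - n * (K * C)\<^sup>2"
    by (simp add: sum_char_exp_sum W_def mean n_def power2_eq_square algebra_simps)
  also have "\<dots> \<le> n * C\<^sup>2 * K * (K + e) - n * (K * C)\<^sup>2"
    using sum_char_exp_sum_square_le[of m l] by (simp add: W_def n_def C_def K_def e_def)
  also have "\<dots> = n * C\<^sup>2 * K * e"
    by (simp add: power2_eq_square algebra_simps)
  finally have "card (atypical m l) / n \<le> 4 * (e / K)"
    using pos by (simp add: field_simps power2_eq_square)
  also have "\<dots> \<le> 4 * (e / 2 ^ m)"
    using K pos by (intro mult_left_mono divide_left_mono) auto
  finally show ?thesis
    by (simp add: n_def e_def)
qed

text \<open>Each summand of \<open>char_exp_sum\<close> is at most exp (l * norm), so the number of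
  characters cancels; \<open>ln 2\<close> is the cost of keeping only half the mean.\<close>

lemma fourier_sup_norm_ge:
  assumes "g \<in> Omega_fin m" "g \<notin> atypical m l" "0 < l"
  shows "2 ^ m * ln (cosh l) - ln 2 \<le> l * fourier_sup_norm m g"
proof -
  let ?M = "fourier_sup_norm m g"
  have K: "0 < card (characters m)"
    using finite_characters characters_nonempty by (simp add: card_gt_0_iff)
  have "card (characters m) * (cosh l ^ 2 ^ m / 2) < char_exp_sum m l g"
    using assms by (simp add: atypical_def char_exp_mean_def)
  also have "\<dots> \<le> (\<Sum>\<psi>\<in>characters m. exp (l * ?M))"
    unfolding char_exp_sum_def
  proof (rule sum_mono)
    fix \<psi> assume "\<psi> \<in> characters m"
    then have "\<bar>fourier m g \<psi>\<bar> \<le> ?M"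
      unfolding fourier_sup_norm_def by (intro Max_ge finite_imageI finite_characters imageI)
    then show "exp (l * fourier m g \<psi>) \<le> exp (l * ?M)"
      using \<open>0 < l\<close> by simp
  qed
  finally have "cosh l ^ 2 ^ m / 2 < exp (l * ?M)"
    using K by simp
  then have "ln (cosh l ^ 2 ^ m / 2) < ln (exp (l * ?M))"
    by (subst ln_less_cancel_iff) simp_all
  then show ?thesis
    by (simp add: ln_div ln_realpow)
qed

section \<open>From counting to probability: Borel-Cantelli and the limit\<close>

lemma measure_cylinder:
  assumes "A \<subseteq> Omega_fin m"
  shows "measure P_Omega (proj m -` A \<inter> Omega) = card A / 2 ^ 2 ^ m"
proof -
  interpret prob_space P_Omega by (rule prob_space_P)
  have fin: "finite A"
    using assms finite_Omega_fin finite_subset by blast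
  have "proj m -` A \<inter> Omega = (\<Union>g\<in>A. proj m -` {g} \<inter> Omega)"
    by auto
  also have "prob \<dots> = (\<Sum>g\<in>A. prob (proj m -` {g} \<inter> Omega))"
    using assms by (intro finite_measure_finite_Union fin)
      (auto simp: disjoint_family_on_def intro!: cylinder_in_sets)
  also have "\<dots> = (\<Sum>g\<in>A. 1 / 2 ^ 2 ^ m)"
    using assms by (intro sum.cong refl) (auto simp: measure_def emeasure_P_cylinder)
  finally show ?thesis
    by simp
qed

theorem mainTheorem4:
  shows "AE f in P_Omega.
    liminf (\<lambda>m. ereal (fourier_sup_norm m (proj m f) / (2 powr (real m / 2) * sqrt (real m))))
      \<ge> ereal (ln 2 / 2)"
proof -
  interpret prob_space P_Omega by (rule prob_space_P)
  \<comment> \<open>For l = c * sqrt m / 2^(m/2) the limiting bound is c / 2, and the failure bound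
    4 exp ((c^2 - ln 2) m) is summable when c^2 < ln 2. The choice c = ln 2 qualifies since ln 2 <
    1.\<close>
  define l where "l m = ln 2 * sqrt m / 2 powr (real m / 2)" for m :: nat
  define B where "B m = proj m -` atypical m (l m) \<inter> Omega" for m
  \<comment> \<open>The bound of \<open>fourier_sup_norm_ge\<close> with cosh l weakened to 1 + l^2
    / 2, divided by \<open>l m * 2 powr (m / 2) * sqrt m\<close>, which equals
    \<open>ln 2 * m\<close>.\<close>
  define b where "b m = (2 powr real m * ln (1 + (ln 2)\<^sup>2 * real m / (2 * 2 powr real m)) - ln 2)
    / (ln 2 * real m)" for m :: nat
  have l_square: "(l m)\<^sup>2 = (ln 2)\<^sup>2 * m / 2 ^ m" for m
    by (simp add: l_def power_mult_distrib power_divide powr_realpow flip: powr_numeral)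
       (simp add: powr_powr powr_realpow)
  have sub: "atypical m (l m) \<subseteq> Omega_fin m" for m
    by (auto simp: atypical_def)
  have prob_B: "prob (B m) \<le> 4 * exp ((ln 2)\<^sup>2 - ln 2) ^ m" for m
  proof -
    have "prob (B m) \<le> 4 * (exp ((l m)\<^sup>2 * 2 ^ m) / 2 ^ m)"
      unfolding B_def measure_cylinder[OF sub] by (rule card_atypical_le)
    also have "\<dots> = 4 * (exp ((ln 2)\<^sup>2 * m) / exp (ln 2 * m))"
      by (simp add: l_square exp_of_nat2_mult)
    also have "\<dots> = 4 * exp ((ln 2)\<^sup>2 - ln 2) ^ m"
      by (simp add: left_diff_distrib flip: exp_diff exp_of_nat2_mult)
    finally show ?thesis .
  qed
  have "(ln 2)\<^sup>2 < (ln 2 :: real)"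
    using ln_2_less_1 by (simp add: power2_eq_square)
  then have "summable (\<lambda>m. 4 * exp ((ln 2)\<^sup>2 - ln (2::real)) ^ m)"
    by (intro summable_mult summable_geometric) simp
  then have "summable (\<lambda>m. prob (B m))"
    by (rule summable_comparison_test') (use prob_B in simp)
  then have "AE f in P_Omega. \<forall>\<^sub>F m in sequentially. f \<in> space P_Omega - B m"
    by (intro borel_cantelli_AE1)
      (simp_all add: B_def sub cylinder_in_sets emeasure_eq_measure)
  then show ?thesis
  proof eventually_elim
    case (elim f)
    have "\<forall>\<^sub>F m in sequentially.
      ereal (b m) \<le> ereal (fourier_sup_norm m (proj m f) / (2 powr (real m / 2) * sqrt (real m)))"
      \<comment> \<open>At m = 0 both \<open>l m\<close> and the normalising factor vanish.\<close>
      using elim eventually_gt_at_top[of 0]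
    proof eventually_elim
      case (elim m)
      have l: "0 < l m"
        using elim by (simp add: l_def)
      have "proj m f \<in> Omega_fin m" "proj m f \<notin> atypical m (l m)"
        using elim by (auto simp: B_def space_P proj_def Omega_def Omega_fin_def)
      then have bound: "2 ^ m * ln (cosh (l m)) - ln 2 \<le> l m * fourier_sup_norm m (proj m f)"
        using fourier_sup_norm_ge l by blast
      have "b m = (2 ^ m * ln (1 + (l m)\<^sup>2 / 2) - ln 2) / (ln 2 * m)"
        by (simp add: b_def l_square powr_realpow mult.commute)
      also have "\<dots> \<le> (2 ^ m * ln (cosh (l m)) - ln 2) / (ln 2 * m)"
        by (intro divide_right_mono diff_right_mono mult_left_mono ln_mono
            one_plus_half_square_le_cosh) (auto intro: add_pos_nonneg)
      also have "\<dots> \<le> l m * fourier_sup_norm m (proj m f) / (ln 2 * m)"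
        using bound by (intro divide_right_mono) auto
      also have "\<dots> = fourier_sup_norm m (proj m f) / (2 powr (real m / 2) * sqrt (real m))"
        using elim by (simp add: l_def field_simps)
      finally show ?case
        by simp
    qed
    then have "liminf (\<lambda>m. ereal (b m)) \<le>
        liminf (\<lambda>m. ereal (fourier_sup_norm m (proj m f) / (2 powr (real m / 2) * sqrt (real m))))"
      by (rule Liminf_mono)
    \<comment> \<open>Since ln (1 + t) ~ t as t tends to 0, the main term tends to ln 2 / 2; the
      remaining -1 / m vanishes.\<close>
    moreover have "b \<longlonglongrightarrow> ln 2 / 2"
      unfolding b_def by (real_asymp simp: power2_eq_square field_simps)
    then have "liminf (\<lambda>m. ereal (b m)) = ereal (ln 2 / 2)"
      by (intro lim_imp_Liminf) auto
    ultimately show ?case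
      by simp
  qed
qed

end
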